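(* $\lambda(ABCA.ACBA.ABCBA)=4$.
   Context: A formula is a finite set of non-empty words over variables (fragments), written separated by dots. An occurrence of a formula $f$ in a word $w$ over an alphabet $\Sigma$ is a non-erasing morphism $h$ from variables to non-empty words over $\Sigma$ such that $h(\phi)$ is a factor of $w$ for every fragment $\phi$; $\lambda(f)$ is the smallest size of an alphabet over which there exists an infinite word containing no occurrence of $f$. *)

theory Defs
  imports "HOL-Library.Omega_Words_Fun" "HOL-Library.Extended_Nat"
begin

datatype var = A | B | C

definition is_formula :: "'v list set \<Rightarrow> bool" where
  "is_formula f \<longleftrightarrow> finite f \<and> [] \<notin> f"

definition morphism_ext :: "('v \<Rightarrow> 'a list) \<Rightarrow> 'v list \<Rightarrow> 'a list" where
  "morphism_ext h \<phi> = concat (map h \<phi>)"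

definition is_factor :: "'a list \<Rightarrow> 'a word \<Rightarrow> bool" where
  "is_factor u w \<longleftrightarrow> (\<exists>i j. i \<le> j \<and> u = w [i \<rightarrow> j])"

definition is_occurrence ::
  "'a set \<Rightarrow> 'v list set \<Rightarrow> 'a word \<Rightarrow> ('v \<Rightarrow> 'a list) \<Rightarrow> bool" where
  "is_occurrence \<Sigma> f w h \<longleftrightarrow>
     (\<forall>x. h x \<in> lists \<Sigma> \<and> h x \<noteq> []) \<and> (\<forall>\<phi>\<in>f. is_factor (morphism_ext h \<phi>) w)"

definition avoidable_over :: "'a set \<Rightarrow> 'v list set \<Rightarrow> bool" where
  "avoidable_over \<Sigma> f \<longleftrightarrow>
     (\<exists>w :: 'a word. range w \<subseteq> \<Sigma> \<and> \<not> (\<exists>h. is_occurrence \<Sigma> f w h))"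

text \<open>Every finite alphabet is equipotent to a set of naturals, so \<open>nat\<close> serves as the universe
  of letters. The infimum in \<open>enat\<close> is a minimum when some finite alphabet works, and is
  \<open>\<infinity>\<close> when the formula is unavoidable.\<close>

definition avoidability_index :: "'v list set \<Rightarrow> enat" where
  "avoidability_index f =
     Inf {enat (card \<Sigma>) | \<Sigma> :: nat set. finite \<Sigma> \<and> avoidable_over \<Sigma> f}"

lemma is_formula_ABCA_ACBA_ABCBA:
  "is_formula {[A, B, C, A], [A, C, B, A], [A, B, C, B, A]}"
  by (simp add: is_formula_def)

end

theory Submission
  imports Defs "HOL-Library.Sublist"
begin

text \<open>
  Upper bound: an occurrence makes all six products of two distinct words among \<open>h A\<close>, \<open>h B\<close>, \<open>h C\<close>
  factors. In the fixed point of \<open>0 \<rightarrow> 01, 1 \<rightarrow> 21, 2 \<rightarrow> 03, 3 \<rightarrow> 23\<close> (Baker, McNulty, Taylor) a letter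
  determines the parity of its position, and a factor of length at least two its position modulo 4.
  Hence all three words have even length, and desubstituting halves them, which gives an infinite
  descent.

  Lower bound: \<open>xxyxx\<close> is the occurrence \<open>A, B \<mapsto> x\<close>, \<open>C \<mapsto> y\<close> of the formula, so every square occurs
  only finitely often in a word avoiding the formula. Far out, an avoiding word over three letters
  therefore has no short squares, and the tree of square-free ternary words avoiding the two
  occurrences \<open>(0, 1, 2)\<close> and \<open>(0, 12, 102)\<close>, up to permutation of the letters, is finite: all its
  words have length at most 47.
\<close>

abbreviation formula :: "var list set" where
  "formula \<equiv> {[A, B, C, A], [A, C, B, A], [A, B, C, B, A]}"

section \<open>Factors of infinite words by position\<close>

definition occurs_at :: "'a word \<Rightarrow> 'a list \<Rightarrow> nat \<Rightarrow> bool" where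
  "occurs_at w u i \<longleftrightarrow> map w [i..<i + length u] = u"

lemma occurs_at_append:
  "occurs_at w (u @ v) i \<longleftrightarrow> occurs_at w u i \<and> occurs_at w v (i + length u)"
proof -
  have "[i..<i + length (u @ v)] = [i..<i + length u] @ [i + length u..<i + length u + length v]"
    using upt_add_eq_append[of i "i + length u" "length v"] by (simp add: add.assoc)
  then show ?thesis
    by (simp add: occurs_at_def)
qed

lemma occurs_at_segment: "occurs_at w (map w [i..<j]) i"
  by (cases "i \<le> j") (simp_all add: occurs_at_def)

lemma is_factor_iff_occurs_at: "is_factor u w \<longleftrightarrow> (\<exists>i. occurs_at w u i)"
proof
  show "is_factor u w \<Longrightarrow> \<exists>i. occurs_at w u i"
    using occurs_at_segment[of w] by (auto simp: is_factor_def subsequence_def)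
  assume "\<exists>i. occurs_at w u i"
  then obtain i where "u = map w [i..<i + length u]"
    unfolding occurs_at_def by metis
  then show "is_factor u w"
    unfolding is_factor_def subsequence_def by (metis le_add1)
qed

lemma is_factor_sublist:
  assumes "sublist u v" "is_factor v w"
  shows "is_factor u w"
  using assms by (auto simp: sublist_def is_factor_iff_occurs_at occurs_at_append)

lemma set_subset_range_of_is_factor: "is_factor u w \<Longrightarrow> set u \<subseteq> range w"
  by (auto simp: is_factor_def subsequence_def)

section \<open>A word over four letters avoiding the formula\<close>

text \<open>The recursion describes the fixed point through its positions: the letter at \<open>2 n\<close> depends on
  the parity of \<open>n\<close> only, the one at \<open>2 n + 1\<close> on whether the letter at \<open>n\<close> is in \<open>{0, 1}\<close>.\<close>

function bmt :: "nat \<Rightarrow> nat" where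
  "bmt n = (if even n then (if 4 dvd n then 0 else 2) else if bmt (n div 2) \<le> 1 then 1 else 3)"
  by auto
termination
  by (relation "measure id") (auto elim!: oddE)

declare bmt.simps [simp del]

lemma bmt_le_3: "bmt n \<le> 3"
  by (subst bmt.simps) auto

lemma even_bmt_iff: "even (bmt n) \<longleftrightarrow> even n"
  by (subst bmt.simps) auto

lemma bmt_eq_parity: "bmt i = bmt j \<Longrightarrow> i mod 2 = j mod 2"
  by (metis even_bmt_iff parity_cases)

lemma bmt_even_eq_iff:
  assumes "even i" "even j"
  shows "bmt i = bmt j \<longleftrightarrow> i mod 4 = j mod 4"
proof -
  have "n mod 4 = (if 4 dvd n then 0 else 2)" if "even n" for n :: nat
    using that by presburger
  then show ?thesis
    using assms bmt.simps[of i] bmt.simps[of j] by auto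
qed

lemma bmt_Suc_double: "bmt (2 * n + 1) = (if bmt n \<le> 1 then 1 else 3)"
  by (subst bmt.simps) simp

text \<open>Desubstitution of one letter: the second letter of its image tells \<open>{0, 1}\<close>
  from \<open>{2, 3}\<close>, and the parity of the position gives the parity of the letter.\<close>

lemma bmt_eqI:
  assumes "i mod 2 = j mod 2" "bmt (2 * i + 1) = bmt (2 * j + 1)"
  shows "bmt i = bmt j"
proof -
  have "even i \<longleftrightarrow> even j"
    using assms(1) by presburger
  then have "even (bmt i) \<longleftrightarrow> even (bmt j)"
    by (simp only: even_bmt_iff)
  moreover have "bmt i \<le> 1 \<longleftrightarrow> bmt j \<le> 1"
    using assms(2) unfolding bmt_Suc_double by (metis numeral_eq_one_iff semiring_norm(84))
  moreover have "x = y" if "x \<le> 3" "y \<le> 3" "even x \<longleftrightarrow> even y" "x \<le> 1 \<longleftrightarrow> y \<le> 1" for x y :: nat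
    using that by presburger
  ultimately show ?thesis
    using bmt_le_3 by blast
qed

section \<open>Repeated factors of the fixed point and descent\<close>

definition same_factor :: "nat \<Rightarrow> nat \<Rightarrow> nat \<Rightarrow> bool" where
  "same_factor i j k \<longleftrightarrow> (\<forall>t<k. bmt (i + t) = bmt (j + t))"

lemma same_factor_parity: "same_factor i j k \<Longrightarrow> k > 0 \<Longrightarrow> i mod 2 = j mod 2"
  using bmt_eq_parity[of i j] by (auto simp: same_factor_def)

text \<open>One of two adjacent positions is even, and an even letter fixes its position modulo
  4.\<close>

lemma same_factor_mod_4:
  assumes "same_factor i j k" "k \<ge> 2"
  shows "i mod 4 = j mod 4"
proof -
  have par: "i mod 2 = j mod 2"
    using assms by (intro same_factor_parity) auto
  show ?thesis
  proof (cases "even i")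
    case True
    then have "even j"
      using par by presburger
    moreover have "bmt i = bmt j"
      using assms(2) spec[OF assms(1)[unfolded same_factor_def], of 0] by simp
    ultimately show ?thesis
      using True bmt_even_eq_iff by blast
  next
    case False
    then have "even (i + 1)" "even (j + 1)"
      using par by presburger+
    moreover have "bmt (i + 1) = bmt (j + 1)"
      using assms(2) spec[OF assms(1)[unfolded same_factor_def], of 1] by simp
    ultimately have "(i + 1) mod 4 = (j + 1) mod 4"
      using bmt_even_eq_iff by blast
    then show ?thesis
      by presburger
  qed
qed

text \<open>Each preimage letter is read off the second letter of its image. That letter lies inside
  the factor even if \<open>i\<close> is odd and the factor starts in the middle of an
  image.\<close>

lemma same_factor_half:
  assumes "same_factor i j k" "i mod 4 = j mod 4" "even k"
  shows "same_factor (i div 2) (j div 2) (k div 2)"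
  unfolding same_factor_def
proof (intro allI impI)
  fix t assume t: "t < k div 2"
  define s where "s = 2 * t + (1 - i mod 2)"
  have "s < k"
    using t assms(3) unfolding s_def by (auto elim!: evenE)
  have "i mod 2 = j mod 2"
    using assms(2) by (metis mod_mod_cancel dvd_triv_left mult_2 numeral_Bit0)
  moreover have "2 * (n div 2 + t) + 1 = n + (2 * t + (1 - n mod 2))" for n :: nat
    by (cases "even n") (auto elim!: evenE oddE)
  ultimately have "2 * (i div 2 + t) + 1 = i + s" "2 * (j div 2 + t) + 1 = j + s"
    unfolding s_def by metis+
  with \<open>s < k\<close> have "bmt (2 * (i div 2 + t) + 1) = bmt (2 * (j div 2 + t) + 1)"
    using assms(1) by (simp add: same_factor_def)
  moreover have "(i div 2 + t) mod 2 = (j div 2 + t) mod 2"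
    using assms(2) by presburger
  ultimately show "bmt (i div 2 + t) = bmt (j div 2 + t)"
    by (rule bmt_eqI[rotated])
qed

lemma dvd_shift_difference:
  fixes m :: nat
  assumes "p mod m = q mod m" "(p + a) mod m = r mod m" "(q + a) mod m = (r + b) mod m"
  shows "m dvd b"
proof -
  have "(r + b) mod m = r mod m"
    using assms mod_add_cong[OF assms(1) refl, of a] by simp
  then show ?thesis
    by (simp add: mod_eq_dvd_iff_nat)
qed

text \<open>The words of length \<open>a\<close>, \<open>b\<close>, \<open>c\<close> are \<open>x\<close>, \<open>y\<close>, \<open>z\<close>, and \<open>xy, yx, xz, zx, yz, zy\<close> occur at the
  positions \<open>i1, \<dots>, i6\<close>.\<close>

lemma no_pairwise_concatenable_factors:
  assumes "a > 0" "b > 0" "c > 0"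
    and "same_factor i1 (i2 + b) a" "same_factor i1 i3 a" "same_factor i1 (i4 + c) a"
    and "same_factor (i1 + a) i2 b" "same_factor (i1 + a) i5 b" "same_factor (i1 + a) (i6 + c) b"
    and "same_factor (i3 + a) i4 c" "same_factor (i3 + a) (i5 + b) c" "same_factor (i3 + a) i6 c"
  shows False
  using assms
proof (induction a arbitrary: b c i1 i2 i3 i4 i5 i6 rule: less_induct)
  case (less a)
  note pos = less.prems(1-3)
  note X = less.prems(4-6) and Y = less.prems(7-9) and Z = less.prems(10-12)
  note par = X[THEN same_factor_parity, OF pos(1)] Y[THEN same_factor_parity, OF pos(2)]
    Z[THEN same_factor_parity, OF pos(3)]
  \<comment> \<open>Each word starts at positions of one parity only. The end of \<open>y\<close> is
    a start of \<open>x\<close> in \<open>yx\<close> and of \<open>z\<close> in \<open>yz\<close>,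
    so \<open>x\<close> and \<open>z\<close> start at the same parity; in \<open>xz\<close> these
    starts are \<open>a\<close> apart. The lengths \<open>b\<close> and \<open>c\<close> are treated
    alike, with \<open>yz\<close> and \<open>zy\<close> after the end of \<open>x\<close>.\<close>
  have "even a"
    by (rule dvd_shift_difference[OF trans[OF par(4)[symmetric] par(5)]
          trans[OF par(1)[symmetric] par(2)] par(8)[symmetric]])
  have "even b"
    by (rule dvd_shift_difference[OF par(2,5,8)])
  have "even c"
    by (rule dvd_shift_difference[OF par(2)[symmetric] par(9,6)])
  have two: "a \<ge> 2" "b \<ge> 2" "c \<ge> 2"
    using pos \<open>even a\<close> \<open>even b\<close> \<open>even c\<close> by (simp_all add: dvd_imp_le)
  note mod4 = X[THEN same_factor_mod_4, OF two(1)] Y[THEN same_factor_mod_4, OF two(2)]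
    Z[THEN same_factor_mod_4, OF two(3)]
  \<comment> \<open>Since the lengths are even, halving keeps adjacent words adjacent, so the
    hypotheses recur with \<open>a div 2 < a\<close>.\<close>
  have div_add: "(i + a) div 2 = i div 2 + a div 2" "(i + b) div 2 = i div 2 + b div 2"
      "(i + c) div 2 = i div 2 + c div 2" for i
    using \<open>even a\<close> \<open>even b\<close> \<open>even c\<close> by (simp_all add: div_plus_div_distrib_dvd_right)
  note halves =
    same_factor_half[OF X(1) mod4(1) \<open>even a\<close>] same_factor_half[OF X(2) mod4(2) \<open>even a\<close>]
    same_factor_half[OF X(3) mod4(3) \<open>even a\<close>] same_factor_half[OF Y(1) mod4(4) \<open>even b\<close>]
    same_factor_half[OF Y(2) mod4(5) \<open>even b\<close>] same_factor_half[OF Y(3) mod4(6) \<open>even b\<close>]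
    same_factor_half[OF Z(1) mod4(7) \<open>even c\<close>] same_factor_half[OF Z(2) mod4(8) \<open>even c\<close>]
    same_factor_half[OF Z(3) mod4(9) \<open>even c\<close>]
  show False
    by (rule less.IH[OF _ _ _ _ halves[unfolded div_add]]) (use two in simp_all)
qed

lemma same_factor_of_occurs_at:
  assumes "occurs_at bmt u i" "occurs_at bmt u j"
  shows "same_factor i j (length u)"
  unfolding same_factor_def
proof (intro allI impI)
  fix t assume "t < length u"
  then have "bmt (i + t) = u ! t" "bmt (j + t) = u ! t"
    using assms by (metis add_diff_cancel_left' length_upt nat_add_left_cancel_less nth_map nth_upt
        occurs_at_def)+
  then show "bmt (i + t) = bmt (j + t)"
    by simp
qed

lemma avoidable_over_four_letters: "avoidable_over {..3::nat} formula"
  unfolding avoidable_over_def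
proof (intro exI[of _ bmt] conjI notI)
  show "range bmt \<subseteq> {..3}"
    using bmt_le_3 by auto
  assume "\<exists>h. is_occurrence {..3} formula bmt h"
  then obtain h where h: "is_occurrence {..3} formula bmt h" ..
  then have ne: "h A \<noteq> []" "h B \<noteq> []" "h C \<noteq> []"
    by (auto simp: is_occurrence_def)
  obtain i j where i: "occurs_at bmt (h A @ h B @ h C @ h A) i"
    and j: "occurs_at bmt (h A @ h C @ h B @ h A) j"
    using h by (auto simp: is_occurrence_def morphism_ext_def is_factor_iff_occurs_at)
  let ?a = "length (h A)" and ?b = "length (h B)" and ?c = "length (h C)"
  have A: "occurs_at bmt (h A) i" "occurs_at bmt (h A) (j + ?a + ?c + ?b)"
      "occurs_at bmt (h A) j" "occurs_at bmt (h A) (i + ?a + ?b + ?c)"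
    and B: "occurs_at bmt (h B) (i + ?a)" "occurs_at bmt (h B) (j + ?a + ?c)"
    and C: "occurs_at bmt (h C) (j + ?a)" "occurs_at bmt (h C) (i + ?a + ?b)"
    using i j by (simp_all add: occurs_at_append)
  \<comment> \<open>\<open>ABCA\<close> supplies the products \<open>AB, BC, CA\<close>, and
    \<open>ACBA\<close> supplies \<open>AC, CB, BA\<close>.\<close>
  show False
    by (rule no_pairwise_concatenable_factors[OF _ _ _
          same_factor_of_occurs_at[OF A(1,2)] same_factor_of_occurs_at[OF A(1,3)]
          same_factor_of_occurs_at[OF A(1,4)] same_factor_of_occurs_at[OF B(1,2)]
          same_factor_of_occurs_at[OF B(1,1)] same_factor_of_occurs_at[OF B(1,2)]
          same_factor_of_occurs_at[OF C(1,2)] same_factor_of_occurs_at[OF C(1,2)]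
          same_factor_of_occurs_at[OF C(1,1)]])
      (use ne in simp_all)
qed

section \<open>Every word over three letters contains the formula\<close>

lemma occurrence_of_factors:
  assumes "range w \<subseteq> \<Sigma>" "x \<noteq> []" "y \<noteq> []" "z \<noteq> []"
    and "is_factor (x @ y @ z @ x) w" "is_factor (x @ z @ y @ x) w" "is_factor (x @ y @ z @ y @ x) w"
  shows "\<exists>h. is_occurrence \<Sigma> formula w h"
proof (intro exI)
  have "set (x @ y @ z @ x) \<subseteq> \<Sigma>"
    using assms set_subset_range_of_is_factor by blast
  then have "case_var x y z v \<in> lists \<Sigma> \<and> case_var x y z v \<noteq> []" for v
    using assms(2-4) by (cases v) auto
  then show "is_occurrence \<Sigma> formula w (case_var x y z)"
    using assms(5-) by (auto simp: is_occurrence_def morphism_ext_def)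
qed

section \<open>Recurring squares\<close>

lemma occurrence_of_repeated_square:
  assumes "range w \<subseteq> \<Sigma>" "x \<noteq> []" "occurs_at w (x @ x) i" "occurs_at w (x @ x) j"
    and "i + 2 * length x < j"
  shows "\<exists>h. is_occurrence \<Sigma> formula w h"
proof -
  define y where "y = map w [i + 2 * length x..<j]"
  have y: "y \<noteq> []" "occurs_at w y (i + 2 * length x)" "i + 2 * length x + length y = j"
    using assms(5) occurs_at_segment by (auto simp: y_def)
  have "occurs_at w ((x @ x) @ y @ (x @ x)) i"
    using assms(3,4) y(2,3) unfolding occurs_at_append[of _ "x @ x"] occurs_at_append[of _ y]
    by (simp add: mult_2)
  then have fac: "is_factor (x @ x @ y @ x @ x) w"
    by (auto simp: is_factor_iff_occurs_at)
  \<comment> \<open>The images of \<open>ABCA\<close> and \<open>ACBA\<close> are the image of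
    \<open>ABCBA\<close> without its last or first \<open>x\<close>.\<close>
  have "sublist (x @ x @ y @ x) (x @ x @ y @ x @ x)" "sublist (x @ y @ x @ x) (x @ x @ y @ x @ x)"
    using sublist_appendI[of "x @ x @ y @ x" "[]" x] sublist_appendI[of "x @ y @ x @ x" x "[]"]
    by simp_all
  then show ?thesis
    using occurrence_of_factors[OF assms(1) assms(2) assms(2) y(1)] fac is_factor_sublist by blast
qed

text \<open>Only finitely many words of length \<open>k\<close> exist, so infinitely many squares
  would repeat one of them arbitrarily far to the right.\<close>

lemma finite_squares_of_period:
  assumes "range w \<subseteq> \<Sigma>" "finite \<Sigma>" "\<nexists>h. is_occurrence \<Sigma> formula w h" "k > 0"
  shows "finite {i. \<exists>x. length x = k \<and> occurs_at w (x @ x) i}"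
proof (rule ccontr)
  let ?S = "{i. \<exists>x. length x = k \<and> occurs_at w (x @ x) i}"
  assume inf: "infinite ?S"
  have "(\<lambda>i. map w [i..<i + k]) ` ?S \<subseteq> {x. set x \<subseteq> \<Sigma> \<and> length x = k}"
    using assms(1) by (auto simp: image_subset_iff)
  then have "finite ((\<lambda>i. map w [i..<i + k]) ` ?S)"
    using finite_lists_length_eq[OF assms(2)] by (rule finite_subset)
  from pigeonhole_infinite[OF inf this] obtain i where i: "i \<in> ?S"
    and rep: "infinite {j \<in> ?S. map w [j..<j + k] = map w [i..<i + k]}"
    by blast
  from rep obtain j where j: "j \<in> ?S" "map w [j..<j + k] = map w [i..<i + k]" "i + 2 * k < j"
    unfolding infinite_nat_iff_unbounded by blast
  obtain x y where "length x = k" "occurs_at w (x @ x) i" "length y = k" "occurs_at w (y @ y) j"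
    using i j(1) by blast
  moreover from this have "y = x"
    using j(2) unfolding occurs_at_append by (simp add: occurs_at_def)
  ultimately show False
    using occurrence_of_repeated_square[OF assms(1), of x i j] assms(3,4) j(3) by auto
qed

lemma eventually_no_short_squares:
  fixes w :: "'a word"
  assumes "range w \<subseteq> \<Sigma>" "finite \<Sigma>" "\<nexists>h. is_occurrence \<Sigma> formula w h"
  obtains N where "\<And>i x. i \<ge> N \<Longrightarrow> x \<noteq> [] \<Longrightarrow> length x \<le> m \<Longrightarrow> \<not> occurs_at w (x @ x) i"
proof -
  have "finite (\<Union>k\<in>{1..m}. {i. \<exists>x. length x = k \<and> occurs_at w (x @ x) i})"
    using finite_squares_of_period[OF assms] by auto
  then obtain N where N: "\<forall>i\<in>(\<Union>k\<in>{1..m}. {i. \<exists>x. length x = k \<and> occurs_at w (x @ x) i}). i < N"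
    using finite_nat_set_iff_bounded by meson
  show thesis
  proof (rule that[of N])
    fix i and x :: "'a list"
    assume *: "i \<ge> N" "x \<noteq> []" "length x \<le> m"
    then have "length x \<in> {1..m}"
      by (cases x) auto
    with N *(1) show "\<not> occurs_at w (x @ x) i"
      by (metis (mono_tags, lifting) UN_I mem_Collect_eq not_less)
  qed
qed

section \<open>Exhaustive search over ternary words\<close>

text \<open>Nested conditionals replace the connectives in the functions below because \<open>code_simp\<close>
  evaluates conditionals lazily, but both arguments of a connective.\<close>

datatype letter = X | Y | Z

fun agree :: "nat \<Rightarrow> 'a list \<Rightarrow> 'a list \<Rightarrow> bool" where
  "agree 0 p q = True"
| "agree (Suc k) (a # p) (b # q) = (if a = b then agree k p q else False)"
| "agree (Suc k) _ _ = False"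

text \<open>Meant for calls where the last argument is \<open>drop k p\<close>; it then looks for a
  square prefix of \<open>p\<close> with period above \<open>k\<close>. Prefixes suffice because the
  search prepends letters.\<close>

fun square_from :: "nat \<Rightarrow> 'a list \<Rightarrow> 'a list \<Rightarrow> bool" where
  "square_from k p [] = False"
| "square_from k p (a # q) = (if agree (Suc k) p q then True else square_from (Suc k) p q)"

definition images :: "'a list \<Rightarrow> 'a list \<Rightarrow> 'a list \<Rightarrow> 'a list list" where
  "images x y z = [x @ y @ z @ x, x @ z @ y @ x, x @ y @ z @ y @ x]"

definition occurrences :: "letter list list list" where
  "occurrences = concat (map (\<lambda>(x, y, z). [images [x] [y] [z], images [x] [y, z] [y, x, z]])
     [(X, Y, Z), (X, Z, Y), (Y, X, Z), (Y, Z, X), (Z, X, Y), (Z, Y, X)])"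

text \<open>The search prepends letters, so a new occurrence has one of its three words as a prefix; testing
  this first is cheap.\<close>

fun contains_all :: "'a list list list \<Rightarrow> 'a list \<Rightarrow> bool" where
  "contains_all [] p = False"
| "contains_all (us # uss) p =
    (if if list_ex (\<lambda>u. prefix u p) us then list_all (\<lambda>u. sublist u p) us else False then True
     else contains_all uss p)"

text \<open>\<open>n\<close> bounds the depth; reaching 0 is inconclusive and counts as
  failure.\<close>

fun refutes :: "letter list list list \<Rightarrow> nat \<Rightarrow> letter list \<Rightarrow> bool" where
  "refutes uss 0 p = False"
| "refutes uss (Suc n) p =
    (if square_from 0 p p then True
     else if contains_all uss p then True
     else if refutes uss n (X # p) then if refutes uss n (Y # p) then refutes uss n (Z # p) else False
     else False)"

lemma agree_imp_take_eq: "agree k p q \<Longrightarrow> take k p = take k q"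
  by (induction k p q rule: agree.induct) (auto split: if_splits)

lemma square_from_imp_square:
  assumes "square_from k p (drop k p)"
  obtains u v where "u \<noteq> []" "p = u @ u @ v"
  using assms
proof (induction k p "drop k p" arbitrary: thesis rule: square_from.induct)
  case (2 k p a q)
  have q: "q = drop (Suc k) p"
    using 2(2) by (metis drop_Suc list.sel(3) tl_drop)
  show ?case
  proof (cases "agree (Suc k) p q")
    case True
    then have "take (Suc k) p = take (Suc k) (drop (Suc k) p)"
      using agree_imp_take_eq q by blast
    then have "p = take (Suc k) p @ take (Suc k) p @ drop (Suc k) (drop (Suc k) p)"
      by (metis append_take_drop_id)
    moreover have "take (Suc k) p \<noteq> []"
      using 2(2) by (cases p) auto
    ultimately show ?thesis
      using 2(3) by blast
  next
    case False
    then show ?thesis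
      using 2 q by (metis square_from.simps(2))
  qed
qed simp

lemma contains_all_imp_sublist:
  "contains_all uss p \<Longrightarrow> \<exists>us\<in>set uss. \<forall>u\<in>set us. sublist u p"
  by (induction uss) (auto simp: list_all_iff split: if_splits)

lemma occurrences_cases:
  assumes "us \<in> set occurrences"
  obtains x y z where "x \<noteq> []" "y \<noteq> []" "z \<noteq> []" "us = images x y z"
  using assms by (auto simp: occurrences_def)

text \<open>Prepending a letter lowers \<open>i\<close> and \<open>n\<close> by one and lengthens
  \<open>p\<close> by one, which preserves both bounds. Hence a square met in the search has period
  at most \<open>m\<close> and starts no earlier than \<open>N\<close>, which is excluded.\<close>

lemma refutes_sound:
  assumes "refutes occurrences n p" "occurs_at w (map f p) i" "range w \<subseteq> range f"
    and "i \<ge> N + n" "length p + n \<le> 2 * m" "range w \<subseteq> \<Sigma>"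
    and "\<And>i x. i \<ge> N \<Longrightarrow> x \<noteq> [] \<Longrightarrow> length x \<le> m \<Longrightarrow> \<not> occurs_at w (x @ x) i"
  shows "\<exists>h. is_occurrence \<Sigma> formula w h"
  using assms(1,2,4,5)
proof (induction n arbitrary: p i)
  case (Suc n)
  consider "square_from 0 p p" | "contains_all occurrences p"
    | "refutes occurrences n (X # p)" "refutes occurrences n (Y # p)" "refutes occurrences n (Z # p)"
    using Suc.prems(1) by (auto split: if_splits)
  then show ?case
  proof cases
    case 1
    then obtain u v where u: "u \<noteq> []" "p = u @ u @ v"
      using square_from_imp_square[of 0 p] by auto
    then have "occurs_at w (map f u @ map f u) i"
      using Suc.prems(2) by (simp add: occurs_at_append)
    moreover have "length (map f u) \<le> m"
      using Suc.prems(4) u by simp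
    ultimately show ?thesis
      using assms(7)[of i "map f u"] Suc.prems(3) u(1) by simp
  next
    case 2
    then obtain us where "us \<in> set occurrences" and sub: "\<forall>u\<in>set us. sublist u p"
      using contains_all_imp_sublist by blast
    then obtain x y z where ne: "x \<noteq> []" "y \<noteq> []" "z \<noteq> []" and us: "us = images x y z"
      using occurrences_cases by blast
    have "is_factor (map f p) w"
      using Suc.prems(2) by (auto simp: is_factor_iff_occurs_at)
    then have "\<forall>u\<in>set us. is_factor (map f u) w"
      using sub by (blast intro: is_factor_sublist map_mono_sublist)
    then have "is_factor (map f (x @ y @ z @ x)) w" "is_factor (map f (x @ z @ y @ x)) w"
        "is_factor (map f (x @ y @ z @ y @ x)) w"
      by (simp_all only: us images_def list.set ball_simps)
    then show ?thesis
      using occurrence_of_factors[OF assms(6), of "map f x" "map f y" "map f z"] ne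
      by (simp only: map_append map_is_Nil_conv not_False_eq_True simp_thms)
  next
    case 3
    obtain c where c: "w (i - 1) = f c"
      using assms(3) by auto
    have "[i - 1..<i + length p] = (i - 1) # [i..<i + length p]"
      using Suc.prems(3) upt_conv_Cons[of "i - 1" "i + length p"] by simp
    then have "occurs_at w (map f (c # p)) (i - 1)"
      using Suc.prems(2,3) c by (simp add: occurs_at_def)
    moreover have "refutes occurrences n (c # p)"
      using 3 by (cases c) auto
    ultimately show ?thesis
      using Suc.IH[of "c # p" "i - 1"] Suc.prems(3,4) by simp
  qed
qed simp

text \<open>Starting from \<open>XY\<close> loses no generality: neighbouring letters differ in the
  absence of squares, and letters can be renamed.\<close>

lemma refutes_occurrences: "refutes occurrences 48 [X, Y]"
  by code_simp

lemma not_avoidable_over_three_letters: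
  assumes "finite \<Sigma>" "card \<Sigma> \<le> 3"
  shows "\<not> avoidable_over \<Sigma> formula"
proof
  assume "avoidable_over \<Sigma> formula"
  then obtain w where w: "range w \<subseteq> \<Sigma>" "\<nexists>h. is_occurrence \<Sigma> formula w h"
    by (auto simp: avoidable_over_def)
  \<comment> \<open>The search keeps \<open>length p + n\<close> at 2 + 48 = 50, so its squares have
    period at most 25.\<close>
  obtain N where N: "\<And>i x. i \<ge> N \<Longrightarrow> x \<noteq> [] \<Longrightarrow> length x \<le> 25 \<Longrightarrow> \<not> occurs_at w (x @ x) i"
    by (rule eventually_no_short_squares[OF w(1) assms(1) w(2), where m = 25]) (rule that)
  \<comment> \<open>The search goes left by at most 48 positions and so never passes
    \<open>N\<close>.\<close>
  define i where "i = N + 48"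
  have ne: "w i \<noteq> w (Suc i)"
    using N[of i "[w i]"] by (simp add: occurs_at_def) (simp add: i_def)
  have "card (\<Sigma> - {w i, w (Suc i)}) = card \<Sigma> - card {w i, w (Suc i)}"
    using w(1) by (intro card_Diff_subset) auto
  then have "card (\<Sigma> - {w i, w (Suc i)}) \<le> Suc 0"
    using assms(2) ne by simp
  then have "\<forall>a\<in>\<Sigma> - {w i, w (Suc i)}. \<forall>b\<in>\<Sigma> - {w i, w (Suc i)}. a = b"
    using assms(1) card_le_Suc0_iff_eq[of "\<Sigma> - {w i, w (Suc i)}"] by blast
  \<comment> \<open>If no third letter is left, any \<open>c\<close> will do.\<close>
  then have "\<exists>c. \<Sigma> - {w i, w (Suc i)} \<subseteq> {c}"
    by blast
  then obtain c where c: "\<Sigma> \<subseteq> {w i, w (Suc i), c}"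
    by blast
  define f where "f = case_letter (w i) (w (Suc i)) c"
  have "occurs_at w (map f [X, Y]) i"
    by (simp add: occurs_at_def f_def)
  moreover have "range w \<subseteq> range f"
  proof
    fix a assume "a \<in> range w"
    then have "a = f X \<or> a = f Y \<or> a = f Z"
      using w(1) c by (auto simp: f_def)
    then show "a \<in> range f"
      by auto
  qed
  ultimately have "\<exists>h. is_occurrence \<Sigma> formula w h"
    by (rule refutes_sound[where N = N and m = 25, OF refutes_occurrences _ _ _ _ w(1)])
      (assumption | rule N | simp add: i_def)+
  then show False
    using w(2) by contradiction
qed

theorem theorem17:
  shows "avoidability_index {[A, B, C, A], [A, C, B, A], [A, B, C, B, A]} = 4"
proof (rule antisym)
  show "avoidability_index formula \<le> 4"
    unfolding avoidability_index_def using avoidable_over_four_letters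
    by (intro Inf_lower CollectI exI[of _ "{..3}"]) (simp add: numeral_eq_enat)
  show "4 \<le> avoidability_index formula"
    unfolding avoidability_index_def
  proof (rule Inf_greatest)
    fix n assume "n \<in> {enat (card \<Sigma>) |\<Sigma> :: nat set. finite \<Sigma> \<and> avoidable_over \<Sigma> formula}"
    then obtain \<Sigma> :: "nat set" where "n = enat (card \<Sigma>)" "finite \<Sigma>" "avoidable_over \<Sigma> formula"
      by blast
    moreover from this have "card \<Sigma> \<ge> 4"
      using not_avoidable_over_three_letters[of \<Sigma>] by linarith
    ultimately show "4 \<le> n"
      by (simp add: numeral_eq_enat)
  qed
qed

end
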